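(* $H^1=H^1_d+H^1_\delta$, and the norms $\|f\|_{H^1}$ and $\|f\|_{H^1_d+H^1_\delta}$ are equivalent, i.e. there are absolute constants $c_1,c_2>0$ such that $c_1\|f\|_{H^1}\le\|f\|_{H^1_d+H^1_\delta}\le c_2\|f\|_{H^1}$ for all $f\in H^1$.
   Context: All functions are on $\mathbb{R}$. An atom with defining interval $I$ (a bounded interval) is a function $a$ with $\operatorname{supp}(a)\subseteq I$, $|a(x)|\le 1/|I|$ and $\int_I a(x)\,dx=0$. $H^1=H^1(\mathbb{R})$ is the Banach space of all $f=\sum_{j=1}^\infty\lambda_j a_j$ (convergence in $L^1$ and in the sense of distributions) with $a_j$ atoms and $\sum_j|\lambda_j|<\infty$, normed by $\|f\|_{H^1}=\inf\sum_j|\lambda_j|$, the infimum being over all such decompositions of $f$. A dyadic interval is an interval $[k2^n,(k+1)2^n)$ with $k,n\in\mathbb{Z}$. $H^1_d$ is defined in the same way as $H^1$, with its own atomic norm $\|\cdot\|_{H^1_d}$, but using only atoms with dyadic defining intervals. For $n,k\in\mathbb{Z}$ the special atom $b_{n,k}$ is $$b_{n,k}=\frac{1}{2^{n+1}}\left[\chi_{[(k-1)2^n,\,k2^n]}-\chi_{[k2^n,\,(k+1)2^n]}\right].$$ $H^1_\delta$ is the Banach space of all $\varphi=\sum_{j=1}^\infty\lambda_j b_{n_j,k_j}$ with $\sum_j|\lambda_j|<\infty$, normed by $\|\varphi\|_{H^1_\delta}=\inf\sum_j|\lambda_j|$ over all such representations. For Banach spaces $B_0,B_1$ of integrable functions,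 $B_0+B_1=\{f_0+f_1:f_i\in B_i\}$ with $\|f\|_{B_0+B_1}=\inf\{\|f_0\|_{B_0}+\|f_1\|_{B_1}: f=f_0+f_1,\ f_i\in B_i\}$. *)

theory Defs
  imports "HOL-Analysis.Analysis"
begin

text \<open>
  Elements of the Lebesgue space over the real line are represented by functions
  \<^typ>\<open>real \<Rightarrow> real\<close>. Since \<open>is_atomic_rep\<close> below sees a function only through integrals, all the
  spaces of this theory contain, with a function, every function almost everywhere equal to it.
\<close>

text \<open>
  The support in an atom is the set of points where the function does not vanish, not the closure
  of that set: otherwise the function equal to \<open>1\<close> on \<open>[0,1/2)\<close> and to \<open>-1\<close> on \<open>[1/2,1)\<close> would
  not be an atom with defining interval \<open>[0,1)\<close>.
\<close>

definition is_atom_on :: "real set \<Rightarrow> (real \<Rightarrow> real) \<Rightarrow> bool" where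
  "is_atom_on I a \<longleftrightarrow>
     a \<in> borel_measurable lebesgue \<and>
     support_on UNIV a \<subseteq> I \<and>
     (\<forall>x. \<bar>a x\<bar> \<le> 1 / measure lebesgue I) \<and>
     (LINT x:I|lebesgue. a x) = 0"

definition bounded_intervals :: "real set set" where
  "bounded_intervals = {I. is_interval I \<and> bounded I \<and> 0 < measure lebesgue I}"

definition dyadic_intervals :: "real set set" where
  "dyadic_intervals = {{of_int k * 2 powi n ..< of_int (k + 1) * 2 powi n} | k n :: int. True}"

definition special_atom :: "int \<Rightarrow> int \<Rightarrow> real \<Rightarrow> real" where
  "special_atom n k x =
     1 / 2 powi (n + 1) *
       (indicator {of_int (k - 1) * 2 powi n .. of_int k * 2 powi n} x
        - indicator {of_int k * 2 powi n .. of_int (k + 1) * 2 powi n} x)"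

definition atoms :: "(real \<Rightarrow> real) set" where
  "atoms = {a. \<exists>I\<in>bounded_intervals. is_atom_on I a}"

definition dyadic_atoms :: "(real \<Rightarrow> real) set" where
  "dyadic_atoms = {a. \<exists>I\<in>dyadic_intervals. is_atom_on I a}"

definition special_atoms :: "(real \<Rightarrow> real) set" where
  "special_atoms = {special_atom n k | n k. True}"

definition test_function :: "(real \<Rightarrow> real) \<Rightarrow> bool" where
  "test_function \<phi> \<longleftrightarrow>
     (\<forall>m x. (deriv ^^ m) \<phi> differentiable (at x)) \<and> compact (closure (support_on UNIV \<phi>))"

definition converges_L1 :: "(nat \<Rightarrow> real \<Rightarrow> real) \<Rightarrow> (real \<Rightarrow> real) \<Rightarrow> bool" where
  "converges_L1 S f \<longleftrightarrow> (\<lambda>N. LINT x|lebesgue. \<bar>S N x - f x\<bar>) \<longlonglongrightarrow> 0"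

definition converges_distr :: "(nat \<Rightarrow> real \<Rightarrow> real) \<Rightarrow> (real \<Rightarrow> real) \<Rightarrow> bool" where
  "converges_distr S f \<longleftrightarrow>
     (\<forall>\<phi>. test_function \<phi> \<longrightarrow>
        (\<lambda>N. LINT x|lebesgue. S N x * \<phi> x) \<longlonglongrightarrow> (LINT x|lebesgue. f x * \<phi> x))"

text \<open>
  For a family \<open>A\<close> of integrable functions: \<open>f\<close> is the sum of the series with coefficients \<open>c j\<close>
  and terms \<open>a j\<close> taken from \<open>A\<close>.
\<close>

definition is_atomic_rep ::
  "(real \<Rightarrow> real) set \<Rightarrow> (nat \<Rightarrow> real) \<Rightarrow> (nat \<Rightarrow> real \<Rightarrow> real) \<Rightarrow> (real \<Rightarrow> real) \<Rightarrow> bool" where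
  "is_atomic_rep A c a f \<longleftrightarrow>
     range a \<subseteq> A \<and>
     summable (\<lambda>j. \<bar>c j\<bar>) \<and>
     integrable lebesgue f \<and>
     converges_L1 (\<lambda>N x. \<Sum>j<N. c j * a j x) f \<and>
     converges_distr (\<lambda>N x. \<Sum>j<N. c j * a j x) f"

definition atomic_space :: "(real \<Rightarrow> real) set \<Rightarrow> (real \<Rightarrow> real) set" where
  "atomic_space A = {f. \<exists>c a. is_atomic_rep A c a f}"

definition atomic_norm :: "(real \<Rightarrow> real) set \<Rightarrow> (real \<Rightarrow> real) \<Rightarrow> real" where
  "atomic_norm A f = Inf {(\<Sum>j. \<bar>c j\<bar>) | c a. is_atomic_rep A c a f}"

definition H1 :: "(real \<Rightarrow> real) set" where
  "H1 = atomic_space atoms"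

definition H1_norm :: "(real \<Rightarrow> real) \<Rightarrow> real" where
  "H1_norm = atomic_norm atoms"

definition H1_dyadic :: "(real \<Rightarrow> real) set" where
  "H1_dyadic = atomic_space dyadic_atoms"

definition H1_dyadic_norm :: "(real \<Rightarrow> real) \<Rightarrow> real" where
  "H1_dyadic_norm = atomic_norm dyadic_atoms"

definition H1_special :: "(real \<Rightarrow> real) set" where
  "H1_special = atomic_space special_atoms"

definition H1_special_norm :: "(real \<Rightarrow> real) \<Rightarrow> real" where
  "H1_special_norm = atomic_norm special_atoms"

text \<open>
  The pointwise equation \<open>f = f0 + f1\<close> expresses the equation between classes because the spaces
  used here are closed under almost everywhere equality.
\<close>

definition sum_space ::
  "(real \<Rightarrow> real) set \<Rightarrow> (real \<Rightarrow> real) set \<Rightarrow> (real \<Rightarrow> real) set" where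
  "sum_space B0 B1 = {f. \<exists>f0\<in>B0. \<exists>f1\<in>B1. f = (\<lambda>x. f0 x + f1 x)}"

definition sum_norm ::
  "(real \<Rightarrow> real) set \<Rightarrow> ((real \<Rightarrow> real) \<Rightarrow> real) \<Rightarrow>
   (real \<Rightarrow> real) set \<Rightarrow> ((real \<Rightarrow> real) \<Rightarrow> real) \<Rightarrow> (real \<Rightarrow> real) \<Rightarrow> real" where
  "sum_norm B0 norm0 B1 norm1 f =
     Inf {norm0 f0 + norm1 f1 | f0 f1. f0 \<in> B0 \<and> f1 \<in> B1 \<and> f = (\<lambda>x. f0 x + f1 x)}"

end

theory Submission
  imports Defs
begin

text \<open>
  One inclusion is immediate: dyadic atoms and special atoms are atoms, so two series that represent
  \<open>f0\<close> and \<open>f1\<close> can be interleaved into one atomic series for \<open>f0 + f1\<close>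
  (\<open>atomic_rep_add\<close>). This bounds the norm of \<^const>\<open>H1\<close> by the norm of the sum space, with
  constant \<open>1\<close>.

  For the other inclusion it suffices to split a single atom \<open>a\<close> with defining interval \<open>I\<close>
  (\<open>atom_split\<close>). If \<open>u\<close> is the power of two with \<open>\<bar>I\<bar> \<le> u < 2 \<bar>I\<bar>\<close>, then \<open>I\<close> lies in the union of
  two adjacent dyadic intervals \<open>J1\<close>, \<open>J2\<close> of length \<open>u\<close>. These need not have a common dyadic
  parent, and this is what the special atoms make up for. Let \<open>A\<close> be the integral of \<open>a\<close> over
  \<open>J1\<close>; as \<open>a\<close> has mean zero, its integral over \<open>J2\<close> is \<open>-A\<close>. Subtracting the mean on each of the
  two intervals leaves two bounded multiples of dyadic atoms, and what was subtracted,
  \<open>(A / u) (\<chi>\<^sub>J\<^sub>1 - \<chi>\<^sub>J\<^sub>2)\<close>, is \<open>2 A\<close> times a special atom. The total of the coefficients is at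
  most \<open>4 + 4 + 4 = 12\<close>.

  Summing over an atomic series of \<open>f\<close> gives three series with absolutely summable coefficients.
  They converge in the mean by completeness of the space of integrable functions
  (\<open>absolutely_summable_converges_L1\<close>), and the two dyadic series are again interleaved. Since test
  functions are bounded, convergence in the mean implies convergence in the sense of distributions,
  so only the former needs to be followed (\<open>is_atomic_rep_iff\<close>).
\<close>

section \<open>Convergence in the mean\<close>

lemma converges_L1_add:
  assumes "\<And>N. integrable lebesgue (S N)" "\<And>N. integrable lebesgue (T N)"
    and "integrable lebesgue f" "integrable lebesgue g"
    and "converges_L1 S f" "converges_L1 T g"
  shows "converges_L1 (\<lambda>N x. S N x + T N x) (\<lambda>x. f x + g x)"
  unfolding converges_L1_def
proof (rule tendsto_sandwich)
  show "\<forall>\<^sub>F N in sequentially. 0 \<le> (LINT x|lebesgue. \<bar>S N x + T N x - (f x + g x)\<bar>)"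
    by simp
  show "\<forall>\<^sub>F N in sequentially. (LINT x|lebesgue. \<bar>S N x + T N x - (f x + g x)\<bar>)
      \<le> (LINT x|lebesgue. \<bar>S N x - f x\<bar>) + (LINT x|lebesgue. \<bar>T N x - g x\<bar>)"
  proof (rule always_eventually, rule allI)
    fix N
    have "(LINT x|lebesgue. \<bar>S N x + T N x - (f x + g x)\<bar>)
        \<le> (LINT x|lebesgue. \<bar>S N x - f x\<bar> + \<bar>T N x - g x\<bar>)"
      using assms by (intro integral_mono integrable_abs Bochner_Integration.integrable_diff
          Bochner_Integration.integrable_add) auto
    also have "\<dots> = (LINT x|lebesgue. \<bar>S N x - f x\<bar>) + (LINT x|lebesgue. \<bar>T N x - g x\<bar>)"
      using assms by (intro Bochner_Integration.integral_add integrable_abs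
          Bochner_Integration.integrable_diff) auto
    finally show "(LINT x|lebesgue. \<bar>S N x + T N x - (f x + g x)\<bar>)
        \<le> (LINT x|lebesgue. \<bar>S N x - f x\<bar>) + (LINT x|lebesgue. \<bar>T N x - g x\<bar>)" .
  qed
  show "(\<lambda>N. (LINT x|lebesgue. \<bar>S N x - f x\<bar>) + (LINT x|lebesgue. \<bar>T N x - g x\<bar>)) \<longlonglongrightarrow> 0"
    using tendsto_add[OF assms(5,6)[unfolded converges_L1_def]] by simp
qed simp

lemma converges_L1_uminus:
  "converges_L1 S f \<Longrightarrow> converges_L1 (\<lambda>N x. - S N x) (\<lambda>x. - f x)"
  unfolding converges_L1_def by (simp add: abs_minus_commute)

lemma converges_L1_subsequence:
  assumes "converges_L1 S f" "filterlim r at_top sequentially"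
  shows "converges_L1 (\<lambda>N. S (r N)) f"
  using filterlim_compose[OF assms(1)[unfolded converges_L1_def] assms(2)]
  unfolding converges_L1_def .

lemma converges_L1_cong_AE:
  assumes "converges_L1 S f"
    and "\<And>N. AE x in lebesgue. S N x = T N x"
    and "\<And>N. S N \<in> borel_measurable lebesgue" "\<And>N. T N \<in> borel_measurable lebesgue"
    and "f \<in> borel_measurable lebesgue"
  shows "converges_L1 T f"
proof -
  have "(LINT x|lebesgue. \<bar>T N x - f x\<bar>) = (LINT x|lebesgue. \<bar>S N x - f x\<bar>)" for N
  proof (rule integral_cong_AE)
    show "AE x in lebesgue. \<bar>T N x - f x\<bar> = \<bar>S N x - f x\<bar>"
      using assms(2)[of N] by eventually_elim simp
  qed (use assms(3-5) in measurable)
  then show ?thesis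
    using assms(1) by (simp add: converges_L1_def)
qed

text \<open>The form in which completeness of the space of integrable functions is used.\<close>

lemma absolutely_summable_converges_L1:
  fixes f :: "nat \<Rightarrow> real \<Rightarrow> real"
  assumes int: "\<And>j. integrable lebesgue (f j)"
    and summ: "summable (\<lambda>j. LINT x|lebesgue. \<bar>f j x\<bar>)"
  obtains g where "integrable lebesgue g" "converges_L1 (\<lambda>N x. \<Sum>j<N. f j x) g"
proof
  have [measurable]: "\<And>j. f j \<in> borel_measurable lebesgue"
    using int by auto
  have int_abs: "integrable lebesgue (\<lambda>x. \<bar>f j x\<bar>)" for j
    using int by simp
  have "(\<integral>\<^sup>+x. (\<Sum>j. ennreal \<bar>f j x\<bar>) \<partial>lebesgue) = (\<Sum>j. \<integral>\<^sup>+x. ennreal \<bar>f j x\<bar> \<partial>lebesgue)"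
    by (intro nn_integral_suminf) measurable
  also have "\<dots> = (\<Sum>j. ennreal (LINT x|lebesgue. \<bar>f j x\<bar>))"
    by (intro arg_cong[where f = suminf] ext nn_integral_eq_integral int_abs) simp
  also have "\<dots> \<noteq> \<infinity>"
    unfolding infinity_ennreal_def by (rule ennreal_suminf_neq_top[OF summ]) simp
  finally have "AE x in lebesgue. (\<Sum>j. ennreal \<bar>f j x\<bar>) \<noteq> \<infinity>"
    by (intro nn_integral_PInf_AE) auto
  then have ae: "AE x in lebesgue. summable (\<lambda>j. \<bar>f j x\<bar>)"
  proof eventually_elim
    case (elim x)
    then show ?case
      by (intro summable_suminf_not_top) (simp_all only: infinity_ennreal_def abs_ge_zero not_False_eq_True)
  qed
  show int_g: "integrable lebesgue (\<lambda>x. \<Sum>j. f j x)"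
    using ae summ by (intro integrable_suminf int) auto
  have "(\<lambda>N. LINT x|lebesgue. \<bar>(\<Sum>j<N. f j x) - (\<Sum>j. f j x)\<bar>)
      \<longlonglongrightarrow> integral\<^sup>L lebesgue (\<lambda>x::real. 0::real)"
  proof (rule integral_dominated_convergence[where w = "\<lambda>x. 2 * (\<Sum>j. \<bar>f j x\<bar>)"])
    show "integrable lebesgue (\<lambda>x. 2 * (\<Sum>j. \<bar>f j x\<bar>))"
      using ae summ int_abs by (intro integrable_mult_right integrable_suminf) auto
    show "AE x in lebesgue. (\<lambda>N. \<bar>(\<Sum>j<N. f j x) - (\<Sum>j. f j x)\<bar>) \<longlonglongrightarrow> 0"
      using ae
    proof eventually_elim
      case (elim x)
      have "(\<lambda>N. \<Sum>j<N. f j x) \<longlonglongrightarrow> (\<Sum>j. f j x)"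
        by (rule summable_LIMSEQ[OF summable_rabs_cancel[OF elim]])
      then show ?case
        by (intro tendsto_rabs_zero LIM_zero)
    qed
    show "AE x in lebesgue. norm \<bar>(\<Sum>j<N. f j x) - (\<Sum>j. f j x)\<bar> \<le> 2 * (\<Sum>j. \<bar>f j x\<bar>)" for N
      using ae
    proof eventually_elim
      case (elim x)
      have "\<bar>\<Sum>j<N. f j x\<bar> \<le> (\<Sum>j<N. \<bar>f j x\<bar>)"
        by (rule sum_abs)
      also have "\<dots> \<le> (\<Sum>j. \<bar>f j x\<bar>)"
        using elim by (intro sum_le_suminf) auto
      finally show ?case
        using summable_rabs[OF elim] unfolding real_norm_def by linarith
    qed
    show "(\<lambda>x. \<bar>(\<Sum>j<N. f j x) - (\<Sum>j. f j x)\<bar>) \<in> borel_measurable lebesgue" for N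
      using borel_measurable_integrable[OF int_g] by measurable
  qed simp
  then show "converges_L1 (\<lambda>N x. \<Sum>j<N. f j x) (\<lambda>x. \<Sum>j. f j x)"
    by (simp add: converges_L1_def)
qed

lemma test_function_bounded:
  assumes "test_function \<phi>"
  obtains B where "\<And>x. \<bar>\<phi> x\<bar> \<le> B"
proof -
  let ?K = "closure (support_on UNIV \<phi>)"
  have "\<And>x. \<phi> differentiable (at x)"
    using assms unfolding test_function_def by (metis funpow_0)
  then have "continuous_on ?K \<phi>"
    by (meson continuous_at_imp_continuous_on differentiable_imp_continuous_within)
  then have "bounded (\<phi> ` ?K)"
    using assms compact_continuous_image compact_imp_bounded
    unfolding test_function_def by blast
  then obtain B where B: "B > 0" "\<And>x. x \<in> ?K \<Longrightarrow> \<bar>\<phi> x\<bar> \<le> B"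
    by (auto simp: bounded_pos)
  show ?thesis
  proof
    fix x
    show "\<bar>\<phi> x\<bar> \<le> B"
      using B closure_subset[of "support_on UNIV \<phi>"]
      by (cases "\<phi> x = 0") (auto simp: support_on_def)
  qed
qed

lemma converges_L1_imp_converges_distr:
  assumes S: "\<And>N. integrable lebesgue (S N)" and f: "integrable lebesgue f"
    and conv: "converges_L1 S f"
  shows "converges_distr S f"
  unfolding converges_distr_def
proof (intro allI impI)
  fix \<phi> assume \<phi>: "test_function \<phi>"
  then obtain B where B: "\<And>x. \<bar>\<phi> x\<bar> \<le> B"
    using test_function_bounded by blast
  have "\<And>x. \<phi> differentiable (at x)"
    using \<phi> unfolding test_function_def by (metis funpow_0)
  then have "continuous_on UNIV \<phi>"
    by (meson continuous_at_imp_continuous_on differentiable_imp_continuous_within)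
  then have "\<phi> \<in> borel_measurable lborel"
    using borel_measurable_continuous_onI by auto
  then have [measurable]: "\<phi> \<in> borel_measurable lebesgue"
    by (rule measurable_completion)
  have int: "integrable lebesgue (\<lambda>x. g x * \<phi> x)" if "integrable lebesgue g" for g
  proof (rule Bochner_Integration.integrable_bound)
    show "integrable lebesgue (\<lambda>x. B * g x)"
      using that by simp
    show "(\<lambda>x. g x * \<phi> x) \<in> borel_measurable lebesgue"
      using that by measurable
    show "AE x in lebesgue. norm (g x * \<phi> x) \<le> norm (B * g x)"
    proof (rule AE_I2)
      fix x
      have "\<bar>\<phi> x\<bar> \<le> \<bar>B\<bar>"
        using B[of x] by simp
      then show "norm (g x * \<phi> x) \<le> norm (B * g x)"
        by (simp add: abs_mult mult.commute mult_right_mono)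
    qed
  qed
  have bound: "\<bar>(LINT x|lebesgue. S N x * \<phi> x) - (LINT x|lebesgue. f x * \<phi> x)\<bar>
      \<le> B * (LINT x|lebesgue. \<bar>S N x - f x\<bar>)" for N
  proof -
    have "(LINT x|lebesgue. S N x * \<phi> x) - (LINT x|lebesgue. f x * \<phi> x)
        = (LINT x|lebesgue. (S N x - f x) * \<phi> x)"
      using int[OF S[of N]] int[OF f] by (simp add: left_diff_distrib)
    also have "\<bar>\<dots>\<bar> \<le> (LINT x|lebesgue. B * \<bar>S N x - f x\<bar>)"
      using S f B by (intro integral_abs_bound_integral int Bochner_Integration.integrable_diff
          integrable_mult_right integrable_abs)
        (auto simp: abs_mult mult.commute mult_right_mono)
    finally show ?thesis
      by simp
  qed
  have "(\<lambda>N. (LINT x|lebesgue. S N x * \<phi> x) - (LINT x|lebesgue. f x * \<phi> x)) \<longlonglongrightarrow> 0"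
  proof (rule Lim_null_comparison)
    show "\<forall>\<^sub>F N in sequentially. norm ((LINT x|lebesgue. S N x * \<phi> x) - (LINT x|lebesgue. f x * \<phi> x))
        \<le> B * (LINT x|lebesgue. \<bar>S N x - f x\<bar>)"
      using bound by simp
    show "(\<lambda>N. B * (LINT x|lebesgue. \<bar>S N x - f x\<bar>)) \<longlonglongrightarrow> 0"
      using tendsto_mult_right_zero[OF conv[unfolded converges_L1_def]] by simp
  qed
  then show "(\<lambda>N. LINT x|lebesgue. S N x * \<phi> x) \<longlonglongrightarrow> (LINT x|lebesgue. f x * \<phi> x)"
    by (rule LIM_zero_cancel)
qed

section \<open>Atoms\<close>

lemma bounded_intervals_lmeasurable:
  "I \<in> bounded_intervals \<Longrightarrow> I \<in> lmeasurable"
  by (simp add: bounded_intervals_def is_interval_convex measurable_convex)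

lemma is_atom_on_zero_outside:
  "is_atom_on I a \<Longrightarrow> x \<notin> I \<Longrightarrow> a x = 0"
  by (auto simp: is_atom_on_def support_on_def)

lemma is_atom_on_integrable:
  assumes "is_atom_on I a" "I \<in> lmeasurable"
  shows "integrable lebesgue a"
  using assms is_atom_on_zero_outside[OF assms(1)]
  by (intro integrableI_bounded_set[where A = I and B = "1 / measure lebesgue I"])
    (auto simp: is_atom_on_def fmeasurable_def)

lemma is_atom_on_L1_norm_le_1:
  assumes "is_atom_on I a" "I \<in> lmeasurable"
  shows "(LINT x|lebesgue. \<bar>a x\<bar>) \<le> 1"
proof -
  have int: "integrable lebesgue (\<lambda>x. indicator I x * C)" for C :: real
    using assms(2) by (intro integrable_mult_left integrable_real_indicator) (auto simp: fmeasurable_def)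
  have "(LINT x|lebesgue. \<bar>a x\<bar>) \<le> (LINT x|lebesgue. indicator I x * (1 / measure lebesgue I))"
  proof (rule integral_mono[OF _ int])
    show "integrable lebesgue (\<lambda>x. \<bar>a x\<bar>)"
      using is_atom_on_integrable[OF assms] by (rule integrable_abs)
    show "\<bar>a x\<bar> \<le> indicator I x * (1 / measure lebesgue I)" for x
      using assms(1) is_atom_on_zero_outside[OF assms(1), of x]
      by (cases "x \<in> I") (simp_all add: is_atom_on_def)
  qed
  also have "\<dots> \<le> 1"
    using assms(2) by simp
  finally show ?thesis .
qed

lemma atoms_integrable: "a \<in> atoms \<Longrightarrow> integrable lebesgue a"
  using bounded_intervals_lmeasurable is_atom_on_integrable unfolding atoms_def by blast

lemma atoms_L1_norm_le_1: "a \<in> atoms \<Longrightarrow> (LINT x|lebesgue. \<bar>a x\<bar>) \<le> 1"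
  using bounded_intervals_lmeasurable is_atom_on_L1_norm_le_1 unfolding atoms_def by blast

lemma measure_dyadic_interval:
  "measure lebesgue {of_int k * 2 powi n ..< of_int (k + 1) * 2 powi n :: real} = 2 powi n"
proof -
  have "of_int k * 2 powi n \<le> (of_int (k + 1) * 2 powi n :: real)"
    by (intro mult_right_mono) auto
  then show ?thesis
    by (simp add: algebra_simps)
qed

lemma dyadic_intervals_subset: "dyadic_intervals \<subseteq> bounded_intervals"
proof
  fix I assume "I \<in> dyadic_intervals"
  then obtain k n :: int where I: "I = {of_int k * 2 powi n ..< of_int (k + 1) * 2 powi n}"
    by (auto simp: dyadic_intervals_def)
  show "I \<in> bounded_intervals"
    using measure_dyadic_interval[of k n]
    by (auto simp: I bounded_intervals_def is_interval_1)
qed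

lemma dyadic_atoms_subset: "dyadic_atoms \<subseteq> atoms"
  using dyadic_intervals_subset by (auto simp: dyadic_atoms_def atoms_def)

lemma special_atoms_subset: "special_atoms \<subseteq> atoms"
proof
  fix b assume "b \<in> special_atoms"
  then obtain n k where b: "b = special_atom n k"
    by (auto simp: special_atoms_def)
  define u :: real where "u = 2 powi n"
  have u: "u > 0" "2 powi (n + 1) = 2 * u"
    by (auto simp: u_def power_int_add)
  define p where "p = of_int k * u"
  have b_eq: "b = (\<lambda>x. 1 / (2 * u) * (indicator {p - u..p} x - indicator {p..p + u} x))"
    unfolding b special_atom_def[abs_def] u(2) unfolding u_def[symmetric]
    by (simp add: p_def algebra_simps)
  define I where "I = {p - u..p + u}"
  have m: "measure lebesgue I = 2 * u"
    using u by (simp add: I_def)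
  have "I \<in> bounded_intervals"
    using u m by (auto simp: bounded_intervals_def I_def is_interval_cc)
  moreover have "is_atom_on I b"
    unfolding is_atom_on_def
  proof (intro conjI allI)
    show "b \<in> borel_measurable lebesgue"
    proof -
      have "b \<in> borel_measurable lborel"
        unfolding b_eq by measurable
      then show ?thesis
        by (rule measurable_completion)
    qed
    show "support_on UNIV b \<subseteq> I"
      using u by (auto simp: support_on_def b_eq I_def indicator_def split: if_splits)
    show "\<bar>b x\<bar> \<le> 1 / measure lebesgue I" for x
      using u by (auto simp: m b_eq indicator_def)
    have "(LINT x:I|lebesgue. b x) = (LINT x|lebesgue. b x)"
      unfolding set_lebesgue_integral_def
      by (intro Bochner_Integration.integral_cong)
        (use u in \<open>auto simp: b_eq I_def indicator_def\<close>)
    also have "\<dots> = 1 / (2 * u) * ((LINT x|lebesgue. indicator {p - u..p} x)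
        - (LINT x|lebesgue. indicator {p..p + u} x))"
      unfolding b_eq
      by (subst Bochner_Integration.integral_diff[symmetric])
        (auto intro!: integrable_real_indicator simp: emeasure_lborel_Icc_eq)
    also have "\<dots> = 0"
      using u by simp
    finally show "(LINT x:I|lebesgue. b x) = 0" .
  qed
  ultimately show "b \<in> atoms"
    by (auto simp: atoms_def)
qed

section \<open>Series of atoms\<close>

lemma integrable_partial_sum:
  assumes "A \<subseteq> atoms" "range a \<subseteq> A"
  shows "integrable lebesgue (\<lambda>x. \<Sum>j<N. c j * a j x)"
  using assms atoms_integrable by (intro Bochner_Integration.integrable_sum) auto

text \<open>For families of atoms the distributional convergence follows from convergence in the mean.\<close>

lemma is_atomic_rep_iff:
  assumes "A \<subseteq> atoms"
  shows "is_atomic_rep A c a f \<longleftrightarrow> range a \<subseteq> A \<and> summable (\<lambda>j. \<bar>c j\<bar>) \<and>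
    integrable lebesgue f \<and> converges_L1 (\<lambda>N x. \<Sum>j<N. c j * a j x) f"
  using integrable_partial_sum[OF assms]
    converges_L1_imp_converges_distr[of "\<lambda>N x. \<Sum>j<N. c j * a j x" f]
  unfolding is_atomic_rep_def by blast

lemma is_atomic_rep_mono:
  "is_atomic_rep A c a f \<Longrightarrow> A \<subseteq> B \<Longrightarrow> is_atomic_rep B c a f"
  by (auto simp: is_atomic_rep_def)

lemma atomic_rep_exists:
  assumes "A \<subseteq> atoms" "range a \<subseteq> A" "summable (\<lambda>j. \<bar>c j\<bar>)"
  obtains f where "is_atomic_rep A c a f"
proof -
  have a: "a j \<in> atoms" for j
    using assms by auto
  have "summable (\<lambda>j. LINT x|lebesgue. \<bar>c j * a j x\<bar>)"
  proof (rule summable_comparison_test'[OF assms(3)])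
    fix j
    show "norm (LINT x|lebesgue. \<bar>c j * a j x\<bar>) \<le> \<bar>c j\<bar>"
      using atoms_L1_norm_le_1[OF a[of j]] by (simp add: abs_mult mult_left_le)
  qed
  moreover have "integrable lebesgue (\<lambda>x. c j * a j x)" for j
    using atoms_integrable[OF a] by simp
  ultimately obtain f where "integrable lebesgue f" "converges_L1 (\<lambda>N x. \<Sum>j<N. c j * a j x) f"
    using absolutely_summable_converges_L1[of "\<lambda>j x. c j * a j x"] by blast
  then show ?thesis
    using that assms by (simp add: is_atomic_rep_iff)
qed

lemma sum_interleave:
  fixes u v :: "nat \<Rightarrow> 'a::comm_monoid_add"
  shows "(\<Sum>j<N. if even j then u (j div 2) else v (j div 2))
    = (\<Sum>j<(N + 1) div 2. u j) + (\<Sum>j<N div 2. v j)"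
proof (induction N)
  case (Suc N)
  show ?case
  proof (cases "even N")
    case True
    then show ?thesis
      using Suc by (auto elim!: evenE simp: ac_simps)
  next
    case False
    then show ?thesis
      using Suc by (auto elim!: oddE simp: ac_simps)
  qed
qed simp

lemma filterlim_div_2: "filterlim (\<lambda>N::nat. N div 2) at_top sequentially"
  unfolding filterlim_at_top
proof
  fix Z :: nat
  show "\<forall>\<^sub>F N in sequentially. Z \<le> N div 2"
    using eventually_ge_at_top[of "2 * Z"] by eventually_elim simp
qed

lemma atomic_rep_add:
  assumes A: "A \<subseteq> atoms" and f: "is_atomic_rep A c a f" and g: "is_atomic_rep A d b g"
  obtains e h where "is_atomic_rep A e h (\<lambda>x. f x + g x)"
    "(\<Sum>j. \<bar>e j\<bar>) = (\<Sum>j. \<bar>c j\<bar>) + (\<Sum>j. \<bar>d j\<bar>)"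
proof
  define e where "e j = (if even j then c (j div 2) else d (j div 2))" for j
  define h where "h j = (if even j then a (j div 2) else b (j div 2))" for j
  note half = filterlim_div_2 filterlim_compose[OF filterlim_div_2 filterlim_add_const_nat_at_top[of 1]]
  have f': "range a \<subseteq> A" "summable (\<lambda>j. \<bar>c j\<bar>)" "integrable lebesgue f"
      "converges_L1 (\<lambda>N x. \<Sum>j<N. c j * a j x) f"
    and g': "range b \<subseteq> A" "summable (\<lambda>j. \<bar>d j\<bar>)" "integrable lebesgue g"
      "converges_L1 (\<lambda>N x. \<Sum>j<N. d j * b j x) g"
    using f g by (auto simp: is_atomic_rep_iff[OF A])
  have "(\<Sum>j<N. \<bar>e j\<bar>) = (\<Sum>j<(N + 1) div 2. \<bar>c j\<bar>) + (\<Sum>j<N div 2. \<bar>d j\<bar>)" for N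
    unfolding sum_interleave[symmetric] by (intro sum.cong) (auto simp: e_def)
  then have "(\<lambda>j. \<bar>e j\<bar>) sums ((\<Sum>j. \<bar>c j\<bar>) + (\<Sum>j. \<bar>d j\<bar>))"
    unfolding sums_def
    using tendsto_add[OF filterlim_compose[OF summable_LIMSEQ[OF f'(2)] half(2)]
        filterlim_compose[OF summable_LIMSEQ[OF g'(2)] half(1)]] by simp
  then have e: "summable (\<lambda>j. \<bar>e j\<bar>)"
    and e_sum: "(\<Sum>j. \<bar>e j\<bar>) = (\<Sum>j. \<bar>c j\<bar>) + (\<Sum>j. \<bar>d j\<bar>)"
    by (auto simp: sums_iff)
  show "(\<Sum>j. \<bar>e j\<bar>) = (\<Sum>j. \<bar>c j\<bar>) + (\<Sum>j. \<bar>d j\<bar>)"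
    by (rule e_sum)
  have "(\<Sum>j<N. e j * h j x) = (\<Sum>j<(N + 1) div 2. c j * a j x) + (\<Sum>j<N div 2. d j * b j x)" for N x
    unfolding sum_interleave[symmetric] by (intro sum.cong) (auto simp: e_def h_def)
  then have "converges_L1 (\<lambda>N x. \<Sum>j<N. e j * h j x) (\<lambda>x. f x + g x)"
    using f' g' converges_L1_subsequence[OF f'(4) half(2)] converges_L1_subsequence[OF g'(4) half(1)]
    by (simp, intro converges_L1_add integrable_partial_sum[OF A]) auto
  moreover have "range h \<subseteq> A"
    using f'(1) g'(1) by (auto simp: h_def)
  ultimately show "is_atomic_rep A e h (\<lambda>x. f x + g x)"
    using e f'(3) g'(3) by (simp add: is_atomic_rep_iff[OF A])
qed

lemma atomic_norm_le:
  assumes "is_atomic_rep A c a f"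
  shows "atomic_norm A f \<le> (\<Sum>j. \<bar>c j\<bar>)"
  unfolding atomic_norm_def
proof (rule cInf_lower)
  show "bdd_below {(\<Sum>j. \<bar>c j\<bar>) |c a. is_atomic_rep A c a f}"
    by (rule bdd_belowI[of _ 0]) (auto simp: is_atomic_rep_def intro: suminf_nonneg)
qed (use assms in auto)

lemma atomic_norm_greatest:
  assumes "f \<in> atomic_space A"
    and "\<And>c a. is_atomic_rep A c a f \<Longrightarrow> C \<le> (\<Sum>j. \<bar>c j\<bar>)"
  shows "C \<le> atomic_norm A f"
  unfolding atomic_norm_def
  using assms by (intro cInf_greatest) (auto simp: atomic_space_def)

section \<open>Splitting an atom\<close>

text \<open>
  Subtracting its mean from a bounded function on \<open>J\<close> at most doubles the bound, hence the
  factor \<open>2 * K\<close>.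
\<close>

lemma mean_corrected_atom:
  fixes a :: "real \<Rightarrow> real"
  assumes J: "J \<in> lmeasurable" "0 < measure lebesgue J"
    and a: "a \<in> borel_measurable lebesgue" "\<And>x. \<bar>a x\<bar> \<le> K / measure lebesgue J" and K: "0 < K"
  defines "A \<equiv> (LINT x:J|lebesgue. a x)"
  shows "is_atom_on J (\<lambda>x. indicator J x * (a x - A / measure lebesgue J) / (2 * K))"
    and "\<bar>A\<bar> \<le> K" and "set_integrable lebesgue J a"
proof -
  let ?m = "measure lebesgue J"
  have [measurable]: "J \<in> sets lebesgue"
    using J(1) by (rule fmeasurableD)
  have finite: "emeasure lebesgue J < \<infinity>"
    using J(1) by (auto simp: fmeasurable_def)
  note [measurable] = a(1)
  show int: "set_integrable lebesgue J a"
    unfolding set_integrable_def using a(2) finite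
    by (intro integrableI_bounded_set[where A = J and B = "K / ?m"]) auto
  have int1: "integrable lebesgue (\<lambda>x. indicator J x * C)" for C :: real
    using finite by simp
  have "\<bar>A\<bar> \<le> (LINT x|lebesgue. indicator J x * (K / ?m))"
    unfolding A_def set_lebesgue_integral_def
    using int int1 a(2) by (intro integral_abs_bound_integral)
      (auto simp: set_integrable_def indicator_def)
  then show A: "\<bar>A\<bar> \<le> K"
    using J finite K by simp
  show "is_atom_on J (\<lambda>x. indicator J x * (a x - A / ?m) / (2 * K))"
    unfolding is_atom_on_def
  proof (intro conjI allI)
    show "(\<lambda>x. indicator J x * (a x - A / ?m) / (2 * K)) \<in> borel_measurable lebesgue"
      by measurable
    show "support_on UNIV (\<lambda>x. indicator J x * (a x - A / ?m) / (2 * K)) \<subseteq> J"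
      by (auto simp: support_on_def indicator_def)
    show "\<bar>indicator J x * (a x - A / ?m) / (2 * K)\<bar> \<le> 1 / ?m" for x
    proof -
      have "\<bar>A / ?m\<bar> \<le> K / ?m"
        using A J by (simp add: divide_right_mono)
      then have "\<bar>a x - A / ?m\<bar> \<le> K / ?m + K / ?m"
        using a(2)[of x] by linarith
      then have "\<bar>a x - A / ?m\<bar> / (2 * K) \<le> 1 / ?m"
        using K by (simp add: field_simps)
      then show ?thesis
        using K by (simp add: indicator_def)
    qed
    have "(LINT x:J|lebesgue. indicator J x * (a x - A / ?m) / (2 * K))
        = (LINT x|lebesgue. (indicator J x * a x - indicator J x * (A / ?m)) / (2 * K))"
      unfolding set_lebesgue_integral_def
      by (intro Bochner_Integration.integral_cong) (auto simp: indicator_def)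
    also have "\<dots> = (A - A) / (2 * K)"
      using int int1[of "A / ?m"] J finite
      by (simp add: set_integrable_def A_def set_lebesgue_integral_def)
    finally show "(LINT x:J|lebesgue. indicator J x * (a x - A / ?m) / (2 * K)) = 0"
      by simp
  qed
qed

lemma dyadic_scale:
  fixes L :: real
  assumes "0 < L"
  obtains n :: int where "L \<le> 2 powi n" "2 powi n < 2 * L"
proof
  let ?n = "\<lceil>log 2 L\<rceil>"
  have eq: "2 powi ?n = (2::real) powr ?n"
    by (simp add: powr_real_of_int')
  have "2 powr (log 2 L) \<le> (2::real) powr ?n"
    by (intro powr_mono) auto
  then show "L \<le> 2 powi ?n"
    using assms by (simp add: eq)
  have "(2::real) powr ?n < 2 powr (log 2 L + 1)"
    by (intro powr_less_mono) linarith+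
  then show "2 powi ?n < 2 * L"
    using assms by (simp add: eq powr_add)
qed

text \<open>
  The interval \<open>I\<close> may contain both of its end points and have length exactly \<open>2 powi n\<close>; the
  half-open union of two dyadic intervals still contains it.
\<close>

lemma interval_in_two_dyadic:
  assumes "I \<in> bounded_intervals"
  obtains k n :: int where
    "I \<subseteq> {of_int k * 2 powi n ..< of_int (k + 2) * 2 powi n}"
    "2 powi n < 2 * measure lebesgue I"
proof -
  let ?L = "measure lebesgue I"
  have I: "is_interval I" "bounded I" "0 < ?L"
    using assms by (auto simp: bounded_intervals_def)
  obtain n :: int where n: "?L \<le> 2 powi n" "2 powi n < 2 * ?L"
    using dyadic_scale[OF I(3)] by blast
  define u :: real where "u = 2 powi n"
  have u: "u > 0"
    by (simp add: u_def)
  have "I \<noteq> {}"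
    using I(3) by auto
  have bdd: "bdd_below I"
    using I(2) by (rule bounded_imp_bdd_below)
  have diam: "y - x \<le> u" if "x \<in> I" "y \<in> I" for x y
  proof (cases "x \<le> y")
    case True
    have "{x..y} \<subseteq> I"
      using I(1)[unfolded is_interval_1] that by (meson atLeastAtMost_iff subsetI)
    then have "measure lebesgue {x..y} \<le> ?L"
      using bounded_intervals_lmeasurable[OF assms] by (intro measure_mono_fmeasurable) auto
    then show ?thesis
      using True n(1) by (simp add: u_def)
  qed (use u in simp)
  define k where "k = \<lfloor>Inf I / u\<rfloor>"
  have k: "of_int k * u \<le> Inf I" "Inf I < (of_int k + 1) * u"
    using floor_correct[of "Inf I / u"] unfolding k_def[symmetric]
    by (simp_all only: pos_le_divide_eq[OF u] pos_divide_less_eq[OF u] of_int_add of_int_1)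
  have "of_int k * u \<le> x \<and> x < of_int (k + 2) * u" if x: "x \<in> I" for x
  proof
    show "of_int k * u \<le> x"
      using k(1) cInf_lower[OF x bdd] by simp
    have "x - u \<le> Inf I"
      using diam[OF _ x] by (intro cInf_greatest \<open>I \<noteq> {}\<close>) (simp add: algebra_simps)
    then show "x < of_int (k + 2) * u"
      using k(2) by (simp add: algebra_simps)
  qed
  then have "I \<subseteq> {of_int k * 2 powi n ..< of_int (k + 2) * 2 powi n}"
    unfolding u_def by (intro subsetI) simp
  then show ?thesis
    using n(2) by (rule that)
qed

text \<open>
  The equation holds almost everywhere only: a special atom is built from closed intervals, so it
  vanishes at the common end point of the two dyadic intervals and not at the right end point of
  the second.
\<close>

lemma atom_split:
  assumes "a \<in> atoms"
  obtains d e s t where "d \<in> dyadic_atoms" "e \<in> dyadic_atoms" "s \<in> special_atoms"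
    "\<bar>t\<bar> \<le> 4" "AE x in lebesgue. a x = 4 * d x + 4 * e x + t * s x"
proof -
  obtain I where I: "I \<in> bounded_intervals" and a: "is_atom_on I a"
    using assms by (auto simp: atoms_def)
  obtain k n :: int where kn: "I \<subseteq> {of_int k * 2 powi n ..< of_int (k + 2) * 2 powi n}"
    "2 powi n < 2 * measure lebesgue I"
    using interval_in_two_dyadic[OF I] by blast
  define u :: real where "u = 2 powi n"
  have u: "u > 0" "2 powi (n + 1) = 2 * u" "u < 2 * measure lebesgue I"
    using kn(2) by (auto simp: u_def power_int_add)
  define J1 :: "real set" where "J1 = {of_int k * u ..< of_int (k + 1) * u}"
  define J2 :: "real set" where "J2 = {of_int (k + 1) * u ..< of_int (k + 2) * u}"
  have J2: "J2 = {of_int (k + 1) * u ..< of_int (k + 1 + 1) * u}"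
    by (simp add: J2_def add.assoc)
  have dyadic: "J1 \<in> dyadic_intervals" "J2 \<in> dyadic_intervals"
    unfolding dyadic_intervals_def J1_def J2 u_def by blast+
  have meas: "J1 \<in> lmeasurable" "J2 \<in> lmeasurable"
    using dyadic dyadic_intervals_subset bounded_intervals_lmeasurable by auto
  have m: "measure lebesgue J1 = u" "measure lebesgue J2 = u"
    using measure_dyadic_interval[of k n] measure_dyadic_interval[of "k + 1" n]
    by (simp_all only: J1_def J2 u_def)
  have "1 / measure lebesgue I \<le> 2 / u"
    using u by (simp add: field_simps)
  then have bound: "\<bar>a x\<bar> \<le> 2 / u" for x
    using a order_trans unfolding is_atom_on_def by blast
  have am: "a \<in> borel_measurable lebesgue"
    using a by (simp add: is_atom_on_def)
  define A where "A = (LINT x:J1|lebesgue. a x)"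
  define d where "d x = indicator J1 x * (a x - A / u) / 4" for x
  define e where "e x = indicator J2 x * (a x + A / u) / 4" for x
  note c1 = mean_corrected_atom[of J1 a 2, unfolded m, OF meas(1) u(1) am bound, folded A_def]
  note c2 = mean_corrected_atom[of J2 a 2, unfolded m, OF meas(2) u(1) am bound]
  have mid: "of_int k * u \<le> of_int (k + 1) * u" "of_int (k + 1) * u \<le> of_int (k + 2) * u"
    using u by (auto intro: mult_right_mono)
  then have Un: "J1 \<union> J2 = {of_int k * u ..< of_int (k + 2) * u}"
    unfolding J1_def J2_def by (rule ivl_disj_un)
  have "A + (LINT x:J2|lebesgue. a x) = (LINT x:J1 \<union> J2|lebesgue. a x)"
    unfolding A_def using c1(3) c2(3)
    by (subst set_integral_Un) (auto simp: J1_def J2_def)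
  also have "\<dots> = (LINT x:I|lebesgue. a x)"
    unfolding set_lebesgue_integral_def
    using kn(1) is_atom_on_zero_outside[OF a]
    by (intro Bochner_Integration.integral_cong) (auto simp: Un u_def indicator_def)
  also have "\<dots> = 0"
    using a by (simp add: is_atom_on_def)
  finally have A2: "(LINT x:J2|lebesgue. a x) = - A"
    by simp
  have "is_atom_on J1 d" "is_atom_on J2 e"
    using c1(1) c2(1) by (simp_all add: d_def[abs_def] e_def[abs_def] A2)
  then have de: "d \<in> dyadic_atoms" "e \<in> dyadic_atoms"
    using dyadic by (auto simp: dyadic_atoms_def)
  have s: "special_atom n (k + 1) \<in> special_atoms"
    by (auto simp: special_atoms_def)
  have t: "\<bar>2 * A\<bar> \<le> 4"
    using c1(2) by simp
  have "AE x in lebesgue. x \<noteq> p" for p :: real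
    using AE_lborel_singleton by (rule AE_completion)
  from this[of "of_int (k + 1) * u"] this[of "of_int (k + 2) * u"]
  have "AE x in lebesgue. a x = 4 * d x + 4 * e x + 2 * A * special_atom n (k + 1) x"
  proof eventually_elim
    case (elim x)
    have sx: "special_atom n (k + 1) x = 1 / (2 * u) * (indicator J1 x - indicator J2 x)"
      using elim unfolding special_atom_def u(2) unfolding u_def[symmetric]
      by (auto simp: J1_def J2_def indicator_def add.assoc simp del: of_int_add)
    have "a x = 0" if "x \<notin> J1" "x \<notin> J2"
      using that kn(1) Un is_atom_on_zero_outside[OF a, of x] by (auto simp: u_def)
    moreover have "\<not> (x \<in> J1 \<and> x \<in> J2)"
      by (auto simp: J1_def J2_def)
    ultimately show ?case
      using u(1) unfolding sx d_def e_def by (auto simp: indicator_def field_simps)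
  qed
  then show ?thesis
    using that de s t by blast
qed

section \<open>The decomposition\<close>

lemma atomic_rep_split:
  assumes f: "is_atomic_rep atoms c a f"
  obtains f0 f1 where "f0 \<in> H1_dyadic" "f1 \<in> H1_special" "f = (\<lambda>x. f0 x + f1 x)"
    "H1_dyadic_norm f0 + H1_special_norm f1 \<le> 12 * (\<Sum>j. \<bar>c j\<bar>)"
proof -
  have f': "range a \<subseteq> atoms" "summable (\<lambda>j. \<bar>c j\<bar>)" "integrable lebesgue f"
      "converges_L1 (\<lambda>N x. \<Sum>j<N. c j * a j x) f"
    using f by (auto simp: is_atomic_rep_def)
  define splits where "splits j d e s t \<longleftrightarrow>
      d \<in> dyadic_atoms \<and> e \<in> dyadic_atoms \<and> s \<in> special_atoms \<and> \<bar>t\<bar> \<le> 4 \<and>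
      (AE x in lebesgue. a j x = 4 * d x + 4 * e x + t * s x)" for j d e s t
  have "\<exists>d e s t. splits j d e s t" for j
  proof -
    have "a j \<in> atoms"
      using f'(1) by auto
    then obtain d e s t where "splits j d e s t"
      by (rule atom_split) (simp add: splits_def)
    then show ?thesis
      by blast
  qed
  then obtain d e s t where "\<And>j. splits j (d j) (e j) (s j) (t j)"
    by metis
  then have d: "\<And>j. d j \<in> dyadic_atoms" and e: "\<And>j. e j \<in> dyadic_atoms"
    and s: "\<And>j. s j \<in> special_atoms" and t: "\<And>j. \<bar>t j\<bar> \<le> 4"
    and split: "\<And>j. AE x in lebesgue. a j x = 4 * d j x + 4 * e j x + t j * s j x"
    unfolding splits_def by blast+
  have c4: "summable (\<lambda>j. \<bar>4 * c j\<bar>)" "(\<Sum>j. \<bar>4 * c j\<bar>) = 4 * (\<Sum>j. \<bar>c j\<bar>)"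
    using f'(2) by (simp_all add: abs_mult suminf_mult)
  have ct_le: "\<bar>c j * t j\<bar> \<le> 4 * \<bar>c j\<bar>" for j
    using mult_left_mono[OF t[of j] abs_ge_zero[of "c j"]] by (simp add: abs_mult)
  have ct: "summable (\<lambda>j. \<bar>c j * t j\<bar>)"
    using ct_le by (intro summable_comparison_test'[OF summable_mult[OF f'(2), of 4]]) simp
  have ct_sum: "(\<Sum>j. \<bar>c j * t j\<bar>) \<le> 4 * (\<Sum>j. \<bar>c j\<bar>)"
    using suminf_le[OF ct_le ct summable_mult[OF f'(2)]] f'(2) by (simp add: suminf_mult)
  have ranges: "range d \<subseteq> dyadic_atoms" "range e \<subseteq> dyadic_atoms" "range s \<subseteq> special_atoms"
    using d e s by auto
  obtain g where g: "is_atomic_rep dyadic_atoms (\<lambda>j. 4 * c j) d g"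
    using atomic_rep_exists[OF dyadic_atoms_subset ranges(1) c4(1)] by blast
  obtain f1 where f1: "is_atomic_rep special_atoms (\<lambda>j. c j * t j) s f1"
    using atomic_rep_exists[OF special_atoms_subset ranges(3) ct] by blast
  have g': "integrable lebesgue g" "converges_L1 (\<lambda>N x. \<Sum>j<N. 4 * c j * d j x) g"
    and f1': "integrable lebesgue f1" "converges_L1 (\<lambda>N x. \<Sum>j<N. c j * t j * s j x) f1"
    using g f1 by (auto simp: is_atomic_rep_def)
  note ints = integrable_partial_sum[OF order_refl f'(1)]
    integrable_partial_sum[OF dyadic_atoms_subset ranges(1)]
    integrable_partial_sum[OF dyadic_atoms_subset ranges(2)]
    integrable_partial_sum[OF special_atoms_subset ranges(3)]
  \<comment> \<open>The sum of the remaining dyadic series is read off from the splitting of the atoms.\<close>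
  have h: "is_atomic_rep dyadic_atoms (\<lambda>j. 4 * c j) e (\<lambda>x. f x + (- g x + - f1 x))"
    unfolding is_atomic_rep_iff[OF dyadic_atoms_subset]
  proof (intro conjI)
    show "integrable lebesgue (\<lambda>x. f x + (- g x + - f1 x))"
      using f'(3) g'(1) f1'(1) by simp
    have "converges_L1 (\<lambda>N x. (\<Sum>j<N. c j * a j x)
        + (- (\<Sum>j<N. 4 * c j * d j x) + - (\<Sum>j<N. c j * t j * s j x)))
        (\<lambda>x. f x + (- g x + - f1 x))"
    proof (rule converges_L1_add)
      show "converges_L1 (\<lambda>N x. - (\<Sum>j<N. 4 * c j * d j x) + - (\<Sum>j<N. c j * t j * s j x))
          (\<lambda>x. - g x + - f1 x)"
        by (rule converges_L1_add)
          (use g' f1' ints in \<open>simp_all add: converges_L1_uminus\<close>)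
    qed (use f'(3,4) g'(1) f1'(1) ints in simp_all)
    then show "converges_L1 (\<lambda>N x. \<Sum>j<N. 4 * c j * e j x) (\<lambda>x. f x + (- g x + - f1 x))"
    proof (rule converges_L1_cong_AE)
      fix N
      have "AE x in lebesgue. \<forall>j. a j x = 4 * d j x + 4 * e j x + t j * s j x"
        using split by (simp add: AE_all_countable)
      then show "AE x in lebesgue. (\<Sum>j<N. c j * a j x)
        + (- (\<Sum>j<N. 4 * c j * d j x) + - (\<Sum>j<N. c j * t j * s j x)) = (\<Sum>j<N. 4 * c j * e j x)"
        by eventually_elim (simp add: algebra_simps sum.distrib)
    qed (use ints f'(3) g'(1) f1'(1) in
        \<open>auto intro!: borel_measurable_add borel_measurable_uminus borel_measurable_integrable\<close>)
  qed (use ranges c4 in auto)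
  obtain b r where br: "is_atomic_rep dyadic_atoms b r (\<lambda>x. g x + (f x + (- g x + - f1 x)))"
    "(\<Sum>j. \<bar>b j\<bar>) = (\<Sum>j. \<bar>4 * c j\<bar>) + (\<Sum>j. \<bar>4 * c j\<bar>)"
    using atomic_rep_add[OF dyadic_atoms_subset g h] by blast
  \<comment> \<open>Taking the dyadic part as a difference makes \<open>f = f0 + f1\<close> hold at every point, although the
    atoms are split almost everywhere only.\<close>
  define f0 where "f0 x = f x - f1 x" for x
  have f0: "is_atomic_rep dyadic_atoms b r f0"
    using br(1) by (simp add: f0_def[abs_def])
  show ?thesis
  proof
    show "f0 \<in> H1_dyadic" "f1 \<in> H1_special"
      using f0 f1 by (auto simp: H1_dyadic_def H1_special_def atomic_space_def)
    show "f = (\<lambda>x. f0 x + f1 x)"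
      by (simp add: f0_def)
    show "H1_dyadic_norm f0 + H1_special_norm f1 \<le> 12 * (\<Sum>j. \<bar>c j\<bar>)"
      using atomic_norm_le[OF f0] atomic_norm_le[OF f1] br(2) c4(2) ct_sum
      unfolding H1_dyadic_norm_def H1_special_norm_def by linarith
  qed
qed

lemma H1_norm_add_le:
  assumes f0: "f0 \<in> H1_dyadic" and f1: "f1 \<in> H1_special"
  shows "(\<lambda>x. f0 x + f1 x) \<in> H1"
    and "H1_norm (\<lambda>x. f0 x + f1 x) \<le> H1_dyadic_norm f0 + H1_special_norm f1"
proof -
  let ?f = "\<lambda>x. f0 x + f1 x"
  have key: "?f \<in> H1 \<and> H1_norm ?f \<le> (\<Sum>j. \<bar>c j\<bar>) + (\<Sum>j. \<bar>d j\<bar>)"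
    if rep: "is_atomic_rep dyadic_atoms c a f0" "is_atomic_rep special_atoms d b f1" for c a d b
  proof -
    obtain e h where "is_atomic_rep atoms e h ?f" "(\<Sum>j. \<bar>e j\<bar>) = (\<Sum>j. \<bar>c j\<bar>) + (\<Sum>j. \<bar>d j\<bar>)"
      using atomic_rep_add[OF order_refl is_atomic_rep_mono[OF rep(1) dyadic_atoms_subset]
          is_atomic_rep_mono[OF rep(2) special_atoms_subset]] by blast
    then show ?thesis
      using atomic_norm_le[of atoms e h ?f] by (auto simp: H1_def H1_norm_def atomic_space_def)
  qed
  show "?f \<in> H1"
    using key f0 f1 by (auto simp: H1_dyadic_def H1_special_def atomic_space_def)
  have "H1_norm ?f - (\<Sum>j. \<bar>d j\<bar>) \<le> H1_dyadic_norm f0"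
    if rep: "is_atomic_rep special_atoms d b f1" for d b
    unfolding H1_dyadic_norm_def
  proof (rule atomic_norm_greatest)
    show "f0 \<in> atomic_space dyadic_atoms"
      using f0 by (simp only: H1_dyadic_def)
    show "H1_norm ?f - (\<Sum>j. \<bar>d j\<bar>) \<le> (\<Sum>j. \<bar>c j\<bar>)" if "is_atomic_rep dyadic_atoms c a f0" for c a
      using key[OF that rep] by linarith
  qed
  then have le: "H1_norm ?f - H1_dyadic_norm f0 \<le> (\<Sum>j. \<bar>d j\<bar>)"
    if "is_atomic_rep special_atoms d b f1" for d b
    using that by (simp add: algebra_simps)
  have "H1_norm ?f - H1_dyadic_norm f0 \<le> H1_special_norm f1"
    unfolding H1_special_norm_def
    by (rule atomic_norm_greatest[OF f1[unfolded H1_special_def] le])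
  then show "H1_norm ?f \<le> H1_dyadic_norm f0 + H1_special_norm f1"
    by simp
qed

theorem proposition2p2:
  shows "H1 = sum_space H1_dyadic H1_special \<and>
    (\<exists>c1 c2 :: real. c1 > 0 \<and> c2 > 0 \<and>
      (\<forall>f\<in>H1.
        c1 * H1_norm f \<le> sum_norm H1_dyadic H1_dyadic_norm H1_special H1_special_norm f \<and>
        sum_norm H1_dyadic H1_dyadic_norm H1_special H1_special_norm f \<le> c2 * H1_norm f))"
proof (intro conjI exI ballI)
  show eq: "H1 = sum_space H1_dyadic H1_special"
  proof (intro subset_antisym subsetI)
    fix f assume "f \<in> H1"
    then obtain c a where "is_atomic_rep atoms c a f"
      by (auto simp: H1_def atomic_space_def)
    then show "f \<in> sum_space H1_dyadic H1_special"
      by (rule atomic_rep_split) (auto simp: sum_space_def)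
  qed (auto simp: sum_space_def H1_norm_add_le(1))
  show "(0::real) < 1" "(0::real) < 12"
    by simp_all
  fix f assume f: "f \<in> H1"
  let ?N = "sum_norm H1_dyadic H1_dyadic_norm H1_special H1_special_norm f"
  let ?V = "{H1_dyadic_norm f0 + H1_special_norm f1 | f0 f1.
    f0 \<in> H1_dyadic \<and> f1 \<in> H1_special \<and> f = (\<lambda>x. f0 x + f1 x)}"
  have "H1_norm f \<le> ?N"
    unfolding sum_norm_def
  proof (rule cInf_greatest)
    show "?V \<noteq> {}"
      using f unfolding eq sum_space_def by blast
  qed (auto simp: H1_norm_add_le(2))
  then show "1 * H1_norm f \<le> ?N"
    by simp
  have "?N / 12 \<le> H1_norm f"
    unfolding H1_norm_def
  proof (rule atomic_norm_greatest)
    show "f \<in> atomic_space atoms"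
      using f by (simp add: H1_def)
    fix c a assume "is_atomic_rep atoms c a f"
    then obtain f0 f1 where f01: "f0 \<in> H1_dyadic" "f1 \<in> H1_special" "f = (\<lambda>x. f0 x + f1 x)"
      and le: "H1_dyadic_norm f0 + H1_special_norm f1 \<le> 12 * (\<Sum>j. \<bar>c j\<bar>)"
      by (rule atomic_rep_split)
    have "?N \<le> H1_dyadic_norm f0 + H1_special_norm f1"
      unfolding sum_norm_def
    proof (rule cInf_lower)
      show "bdd_below ?V"
        by (rule bdd_belowI[of _ "H1_norm f"]) (auto simp: H1_norm_add_le(2))
    qed (use f01 in blast)
    then show "?N / 12 \<le> (\<Sum>j. \<bar>c j\<bar>)"
      using le by simp
  qed
  then show "?N \<le> 12 * H1_norm f"
    by simp
qed

end
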